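(* Let $\Phi=(A;\{E_i\}_{i=0}^d;A^*;\{E^*_i\}_{i=0}^d)$ be a tridiagonal system on $V$, and let $\mathcal{D}$ (resp. $\mathcal{D}^*$) be the $\mathbb{K}$-subalgebra of $\mathrm{End}(V)$ generated by $A$ (resp. $A^*$). Then the following (i), (ii) hold. (i) The span of $E^*_0\mathcal{D}\mathcal{D}^*\mathcal{D}E^*_0$ is equal to the span of $E^*_0\mathcal{D}E^*_0\mathcal{D}E^*_0$; that is, $$\mathrm{Span}\{E^*_0XYZE^*_0 \mid X,Z\in\mathcal{D},\ Y\in\mathcal{D}^*\}=\mathrm{Span}\{E^*_0XE^*_0ZE^*_0 \mid X,Z\in\mathcal{D}\}.$$ (ii) The elements of $E^*_0\mathcal{D}E^*_0=\{E^*_0XE^*_0\mid X\in\mathcal{D}\}$ mutually commute.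
   Context: $\mathbb{K}$ is a field and $V$ is a vector space over $\mathbb{K}$ with finite positive dimension. $\mathrm{End}(V)$ is the $\mathbb{K}$-algebra of all $\mathbb{K}$-linear transformations from $V$ to $V$, with identity $I$. An element of $\mathrm{End}(V)$ is diagonalizable if $V$ is spanned by its eigenspaces (for eigenvalues in $\mathbb{K}$). A tridiagonal pair on $V$ is an ordered pair $A,A^*\in\mathrm{End}(V)$ ($A^*$ is just a symbol, not an adjoint) such that: (i) each of $A,A^*$ is diagonalizable; (ii) there is an ordering $\{V_i\}_{i=0}^d$ of the eigenspaces of $A$ such that $A^*V_i\subseteq V_{i-1}+V_i+V_{i+1}$ for $0\le i\le d$, where $V_{-1}=0$, $V_{d+1}=0$; (iii) there is an ordering $\{V^*_i\}_{i=0}^\delta$ of the eigenspaces of $A^*$ such that $AV^*_i\subseteq V^*_{i-1}+V^*_i+V^*_{i+1}$ for $0\le i\le\delta$, where $V^*_{-1}=0$, $V^*_{\delta+1}=0$; (iv) there is no subspace $W$ of $V$ with $AW\subseteq W$, $A^*W\subseteq W$, $W\ne 0$, $W\ne V$. It is known that $d=\delta$. Orderings of the eigenspaces of $A$ (resp. $A^*$) as in (ii) (resp. (iii)) are called standard. Given an ordering $\{V_i\}_{i=0}^d$ of the eigenspaces of a diagonalizable map, the primitive idempotent $E_i$ corresponding to $V_i$ is the linear map with $(E_i-I)V_i=0$ and $E_iV_j=0$ for $j\neq i$; an ordering of the primitive idempotents is standard if the corresponding ordering of the eigenspaces is standard. A tridiagonal system on $V$ is a sequence $(A;\{E_i\}_{i=0}^d;A^*;\{E^*_i\}_{i=0}^d)$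 such that $A,A^*$ is a tridiagonal pair on $V$, $\{E_i\}_{i=0}^d$ is a standard ordering of the primitive idempotents of $A$, and $\{E^*_i\}_{i=0}^d$ is a standard ordering of the primitive idempotents of $A^*$. *)

theory Defs
  imports HOL.Vector_Spaces "HOL-Library.Function_Algebras"
begin

text \<open>
  The vector space \<open>V\<close> is the whole type \<open>'b\<close> with scalar multiplication \<open>scale\<close>, as in the
  library locale \<^locale>\<open>vector_space\<close>. Endomorphisms are functions \<open>'b \<Rightarrow> 'b\<close> with pointwise
  addition; their product is composition \<open>\<circ>\<close>, not the pointwise product.
\<close>

context vector_space
begin

definition End :: "('b \<Rightarrow> 'b) set" where
  "End = {f. Vector_Spaces.linear scale scale f}"

definition End_scale :: "'a \<Rightarrow> ('b \<Rightarrow> 'b) \<Rightarrow> 'b \<Rightarrow> 'b" where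
  "End_scale c f = (\<lambda>v. scale c (f v))"

lemma vector_space_End_scale: "vector_space End_scale"
  by unfold_locales
    (auto simp: End_scale_def fun_eq_iff scale_right_distrib scale_left_distrib)

definition End_span :: "('b \<Rightarrow> 'b) set \<Rightarrow> ('b \<Rightarrow> 'b) set" where
  "End_span = module.span End_scale"

text \<open>Subalgebras contain the identity of \<open>End\<close>.\<close>

definition subalgebra :: "('b \<Rightarrow> 'b) set \<Rightarrow> bool" where
  "subalgebra S \<longleftrightarrow> S \<subseteq> End \<and> id \<in> S \<and>
     (\<forall>f\<in>S. \<forall>g\<in>S. f + g \<in> S) \<and>
     (\<forall>c. \<forall>f\<in>S. End_scale c f \<in> S) \<and>
     (\<forall>f\<in>S. \<forall>g\<in>S. f \<circ> g \<in> S)"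

definition generated_subalgebra :: "('b \<Rightarrow> 'b) \<Rightarrow> ('b \<Rightarrow> 'b) set" where
  "generated_subalgebra A = subalgebra hull {A}"

definition eigenspaces :: "('b \<Rightarrow> 'b) \<Rightarrow> 'b set set" where
  "eigenspaces A = {W. W \<noteq> {0} \<and> (\<exists>\<theta>. W = {v. A v = scale \<theta> v})}"

definition diagonalizable :: "('b \<Rightarrow> 'b) \<Rightarrow> bool" where
  "diagonalizable A \<longleftrightarrow> span (\<Union>(eigenspaces A)) = UNIV"

text \<open>The family \<open>U 0, \<dots>, U d\<close> extended by \<open>0\<close> to all integer indices.\<close>

definition zero_extend :: "nat \<Rightarrow> (nat \<Rightarrow> 'b set) \<Rightarrow> int \<Rightarrow> 'b set" where
  "zero_extend d U j = (if 0 \<le> j \<and> j \<le> int d then U (nat j) else {0})"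

text \<open>\<open>U 0, \<dots>, U d\<close> lists the eigenspaces of \<open>A\<close> without repetition, and \<open>B\<close> acts on it
  in block tridiagonal fashion.\<close>

definition standard_ordering ::
    "('b \<Rightarrow> 'b) \<Rightarrow> ('b \<Rightarrow> 'b) \<Rightarrow> nat \<Rightarrow> (nat \<Rightarrow> 'b set) \<Rightarrow> bool" where
  "standard_ordering A B d U \<longleftrightarrow> bij_betw U {0..d} (eigenspaces A) \<and>
     (\<forall>i\<in>{0..d}. B ` U i \<subseteq>
        {x + y + z | x y z. x \<in> zero_extend d U (int i - 1) \<and>
                            y \<in> zero_extend d U (int i) \<and>
                            z \<in> zero_extend d U (int i + 1)})"

definition tridiagonal_pair :: "('b \<Rightarrow> 'b) \<Rightarrow> ('b \<Rightarrow> 'b) \<Rightarrow> bool" where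
  "tridiagonal_pair A A' \<longleftrightarrow> A \<in> End \<and> A' \<in> End \<and>
     diagonalizable A \<and> diagonalizable A' \<and>
     (\<exists>d U. standard_ordering A A' d U) \<and>
     (\<exists>\<delta> U'. standard_ordering A' A \<delta> U') \<and>
     \<not> (\<exists>W. subspace W \<and> A ` W \<subseteq> W \<and> A' ` W \<subseteq> W \<and> W \<noteq> {0} \<and> W \<noteq> UNIV)"

definition primitive_idempotents ::
    "nat \<Rightarrow> (nat \<Rightarrow> 'b set) \<Rightarrow> (nat \<Rightarrow> 'b \<Rightarrow> 'b) \<Rightarrow> bool" where
  "primitive_idempotents d U E \<longleftrightarrow>
     (\<forall>i\<in>{0..d}. E i \<in> End \<and> (\<forall>v\<in>U i. (E i - id) v = 0) \<and>
        (\<forall>j\<in>{0..d}. j \<noteq> i \<longrightarrow> (\<forall>v\<in>U j. E i v = 0)))"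

definition standard_idempotents ::
    "('b \<Rightarrow> 'b) \<Rightarrow> ('b \<Rightarrow> 'b) \<Rightarrow> nat \<Rightarrow> (nat \<Rightarrow> 'b \<Rightarrow> 'b) \<Rightarrow> bool" where
  "standard_idempotents A B d E \<longleftrightarrow>
     (\<exists>U. standard_ordering A B d U \<and> primitive_idempotents d U E)"

definition tridiagonal_system ::
    "nat \<Rightarrow> ('b \<Rightarrow> 'b) \<Rightarrow> (nat \<Rightarrow> 'b \<Rightarrow> 'b) \<Rightarrow> ('b \<Rightarrow> 'b) \<Rightarrow> (nat \<Rightarrow> 'b \<Rightarrow> 'b) \<Rightarrow> bool" where
  "tridiagonal_system d A E A' E' \<longleftrightarrow> tridiagonal_pair A A' \<and>
     standard_idempotents A A' d E \<and> standard_idempotents A' A d E'"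

end

end

theory Submission
  imports Defs
begin

text \<open>
  Write \<open>f i j k = E'\<^sub>0 E\<^sub>i E'\<^sub>j E\<^sub>k E'\<^sub>0\<close>. These elements span \<open>E'\<^sub>0 D D' D E'\<^sub>0\<close>, because the
  primitive idempotents of \<open>A\<close> and of \<open>A'\<close> are bases of \<open>D\<close> and \<open>D'\<close>; those with \<open>j = 0\<close> span
  \<open>E'\<^sub>0 D E'\<^sub>0 D E'\<^sub>0\<close>. Block tridiagonality enters only through \<open>E\<^sub>i A'\<^sup>t E\<^sub>k = 0\<close> and
  \<open>E'\<^sub>i A\<^sup>t E'\<^sub>k = 0\<close> for \<open>t < \<bar>i - k\<bar>\<close>. Expanding the powers in idempotents turns this into linear
  relations among the \<open>f i j k\<close>: with \<open>\<theta>\<close>, \<open>\<theta>'\<close> the eigenvalues of \<open>A\<close>, \<open>A'\<close>,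
  \<^item> \<open>\<Sum>\<^sub>j \<theta>'\<^sub>j\<^sup>t f i j k = 0\<close> for \<open>t < \<bar>i - k\<bar>\<close>,
  \<^item> \<open>\<Sum>\<^sub>k \<theta>\<^sub>k\<^sup>s f i j k = 0\<close> and \<open>\<Sum>\<^sub>i \<theta>\<^sub>i\<^sup>s f i j k = 0\<close> for \<open>s < j\<close>.

  Both claims follow from these relations alone. The tool is the invertibility of Vandermonde
  matrices: a family that satisfies \<open>m\<close> such power relations and has at most \<open>m\<close> nonzero
  members vanishes. Descending on \<open>j\<close>, the relations of the first kind kill the entries \<open>f i j k\<close> far
  from the diagonal \<open>i = k\<close>, and those of the second kind then kill the band that is
  left, one row and one column at a time. For this the band must be narrow enough, and one further piece of information
  makes it so: either \<open>f i 0 k = 0\<close> for all \<open>i, k\<close>, or \<open>f i j i = 0\<close> for all \<open>i, j\<close>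
  (lemma \<open>triple_family_in_subspace\<close>).

  The first alternative, read modulo the span of \<open>E'\<^sub>0 D E'\<^sub>0 D E'\<^sub>0\<close>, gives the equality of spans. The
  second, applied to \<open>f i j k - f k j i\<close>, gives \<open>f i 0 k = f k 0 i\<close>, which says that the
  elements \<open>E'\<^sub>0 E\<^sub>i E'\<^sub>0\<close> commute.
\<close>

context vector_space
begin

section \<open>Vandermonde arguments modulo a subspace\<close>

text \<open>
  Working modulo \<open>S\<close>, combining consecutive power sums multiplies the \<open>i\<close>-th term by
  \<open>\<theta> i - \<theta> a\<close> and so removes the term of index \<open>a\<close>.
\<close>

lemma vandermonde_subspace:
  assumes "subspace S" "finite I" "inj_on \<theta> I"
    and "\<And>t. t < card I \<Longrightarrow> (\<Sum>i\<in>I. scale (\<theta> i ^ t) (g i)) \<in> S"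
    and "i \<in> I"
  shows "g i \<in> S"
  using assms(2-)
proof (induction I arbitrary: g i rule: finite_induct)
  case empty
  then show ?case by simp
next
  case (insert a I)
  define g' where "g' i = scale (\<theta> i - \<theta> a) (g i)" for i
  have "(\<Sum>i\<in>I. scale (\<theta> i ^ t) (g' i)) \<in> S" if t: "t < card I" for t
  proof -
    have "(\<Sum>i\<in>I. scale (\<theta> i ^ t) (g' i)) = (\<Sum>i\<in>insert a I. scale (\<theta> i ^ t) (g' i))"
      using insert.hyps by (simp add: g'_def)
    also have "\<dots> = (\<Sum>i\<in>insert a I. scale (\<theta> i ^ Suc t) (g i) - scale (\<theta> a) (scale (\<theta> i ^ t) (g i)))"
      by (intro sum.cong refl) (simp add: g'_def algebra_simps)
    also have "\<dots> = (\<Sum>i\<in>insert a I. scale (\<theta> i ^ Suc t) (g i))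
        - scale (\<theta> a) (\<Sum>i\<in>insert a I. scale (\<theta> i ^ t) (g i))"
      unfolding sum_subtractf scale_sum_right ..
    also have "\<dots> \<in> S"
      by (intro subspace_diff subspace_scale assms(1) insert.prems) (use t insert.hyps in auto)
    finally show ?thesis .
  qed
  then have "g' i \<in> S" if "i \<in> I" for i
    using insert.IH[of g'] insert.prems that by simp
  then have I: "g i \<in> S" if "i \<in> I" for i
  proof -
    have ne: "\<theta> i - \<theta> a \<noteq> 0"
      using insert.prems(1) insert.hyps that by (auto simp: inj_on_def)
    have "scale (inverse (\<theta> i - \<theta> a)) (g' i) \<in> S"
      using \<open>\<And>i. i \<in> I \<Longrightarrow> g' i \<in> S\<close> that by (intro subspace_scale assms(1))
    then show ?thesis using ne by (simp add: g'_def)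
  qed
  have "g a = (\<Sum>i\<in>insert a I. scale (\<theta> i ^ 0) (g i)) - (\<Sum>i\<in>I. g i)"
    using insert.hyps by simp
  also have "\<dots> \<in> S"
    by (intro subspace_diff subspace_sum assms(1) insert.prems I) (use insert.hyps in auto)
  finally show ?case using I insert.prems by auto
qed

text \<open>Terms that already lie in \<open>S\<close> do not count: only the exceptional indices need relations.\<close>

lemma vandermonde_subspace_exceptions:
  assumes S: "subspace S" and "finite I" and inj: "inj_on \<theta> I"
    and exc: "{i \<in> I. g i \<notin> S} \<subseteq> J" "finite J" "card J \<le> m"
    and sums: "\<And>t. t < m \<Longrightarrow> (\<Sum>i\<in>I. scale (\<theta> i ^ t) (g i)) \<in> S"
    and "i \<in> I"
  shows "g i \<in> S"
proof (rule ccontr)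
  define B where "B = {i \<in> I. g i \<notin> S}"
  assume "g i \<notin> S"
  have B: "B \<subseteq> I" "finite B" "card B \<le> m"
    using assms card_mono[of J B] by (auto simp: B_def)
  have "(\<Sum>i\<in>B. scale (\<theta> i ^ t) (g i)) \<in> S" if "t < card B" for t
  proof -
    have "(\<Sum>i\<in>B. scale (\<theta> i ^ t) (g i)) =
        (\<Sum>i\<in>I. scale (\<theta> i ^ t) (g i)) - (\<Sum>i\<in>I - B. scale (\<theta> i ^ t) (g i))"
      using B(1) \<open>finite I\<close> by (simp add: sum.subset_diff)
    also have "\<dots> \<in> S"
      using that B by (intro subspace_diff subspace_sum subspace_scale S sums) (auto simp: B_def)
    finally show ?thesis .
  qed
  moreover have "i \<in> B" using \<open>g i \<notin> S\<close> \<open>i \<in> I\<close> by (simp add: B_def)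
  ultimately have "g i \<in> S"
    using vandermonde_subspace[OF S B(2) inj_on_subset[OF inj B(1)]] by blast
  with \<open>g i \<notin> S\<close> show False ..
qed

section \<open>Families with three indices\<close>

text \<open>
  Fix \<open>j\<close> and suppose that \<open>f i j' k \<in> S\<close> for all \<open>j' > j\<close>. If \<open>f i 0 k \<in> S\<close> for all \<open>i, k\<close>, the exceptional
  indices \<open>j'\<close> lie in \<open>{1..j}\<close>, so hypothesis \<open>mid\<close> settles all \<open>\<bar>i - k\<bar> \<ge> j\<close>; otherwise they
  lie in \<open>{0..j}\<close>, so it settles all \<open>\<bar>i - k\<bar> > j\<close>, and the diagonal is in \<open>S\<close> by assumption. In both cases,
  once the rows and columns before \<open>i\<close> are done, at most \<open>j\<close> exceptional entries remain in row \<open>i\<close>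
  and in column \<open>i\<close>. This is the number of relations that \<open>right\<close> and \<open>left\<close> provide.
\<close>

lemma triple_family_in_subspace:
  fixes f :: "nat \<Rightarrow> nat \<Rightarrow> nat \<Rightarrow> 'b"
  assumes S: "subspace S" and inj: "inj_on \<theta> {..d}" and inj': "inj_on \<theta>' {..d}"
    and mid: "\<And>i k t. i \<le> d \<Longrightarrow> k \<le> d \<Longrightarrow> i + t < k \<or> k + t < i \<Longrightarrow>
      (\<Sum>j\<le>d. scale (\<theta>' j ^ t) (f i j k)) \<in> S"
    and right: "\<And>i j s. i \<le> d \<Longrightarrow> j \<le> d \<Longrightarrow> s < j \<Longrightarrow> (\<Sum>k\<le>d. scale (\<theta> k ^ s) (f i j k)) \<in> S"
    and left: "\<And>k j s. k \<le> d \<Longrightarrow> j \<le> d \<Longrightarrow> s < j \<Longrightarrow> (\<Sum>i\<le>d. scale (\<theta> i ^ s) (f i j k)) \<in> S"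
    and boundary: "(\<forall>i\<le>d. \<forall>k\<le>d. f i 0 k \<in> S) \<or> (\<forall>i\<le>d. \<forall>j\<le>d. f i j i \<in> S)"
    and "i \<le> d" "j \<le> d" "k \<le> d"
  shows "f i j k \<in> S"
  using \<open>i \<le> d\<close> \<open>j \<le> d\<close> \<open>k \<le> d\<close>
proof (induction "d - j" arbitrary: i j k rule: less_induct)
  case less
  have above: "f i j' k \<in> S" if "j < j'" "j' \<le> d" "i \<le> d" "k \<le> d" for i j' k
    using less.hyps[of j' i k] that less.prems by auto
  have column: "f i j k \<in> S"
    if "i \<le> d" "k \<le> d" and J: "{j' \<in> {..d}. f i j' k \<notin> S} \<subseteq> J" "finite J"
      and far: "i + card J \<le> k \<or> k + card J \<le> i" for i k J
  proof (rule vandermonde_subspace_exceptions[OF S _ inj' J order.refl, where i = j])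
    show "(\<Sum>j\<le>d. scale (\<theta>' j ^ t) (f i j k)) \<in> S" if "t < card J" for t
      using that far \<open>i \<le> d\<close> \<open>k \<le> d\<close> by (intro mid) auto
  qed (use less.prems in auto)
  \<comment> \<open>The window of possible exceptions to the right of the diagonal has length \<open>j\<close>; it starts on
    the diagonal (\<open>e = 0\<close>) or just after it (\<open>e = 1\<close>), according to the boundary condition.\<close>
  obtain e where e: "\<And>i k. i \<le> k \<Longrightarrow> k \<le> d \<Longrightarrow> k \<notin> {i + e..<i + e + j} \<Longrightarrow> f i j k \<in> S \<and> f k j i \<in> S"
  proof (cases "\<forall>i\<le>d. \<forall>k\<le>d. f i 0 k \<in> S")
    case True
    have J: "{j' \<in> {..d}. f i j' k \<notin> S} \<subseteq> {1..j}" if "i \<le> d" "k \<le> d" for i k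
      using that True above by (force simp: not_less_eq_eq[symmetric] Suc_le_eq intro: ccontr gr0I)
    show ?thesis
    proof (rule that[of 0])
      fix i k assume "i \<le> k" "k \<le> d" "k \<notin> {i + 0..<i + 0 + j}"
      then show "f i j k \<in> S \<and> f k j i \<in> S"
        using column[OF _ _ J, of i k] column[OF _ _ J, of k i] by auto
    qed
  next
    case False
    have J: "{j' \<in> {..d}. f i j' k \<notin> S} \<subseteq> {..j}" if "i \<le> d" "k \<le> d" for i k
      using that above by (force intro: ccontr)
    show ?thesis
    proof (rule that[of 1])
      fix i k assume *: "i \<le> k" "k \<le> d" "k \<notin> {i + 1..<i + 1 + j}"
      show "f i j k \<in> S \<and> f k j i \<in> S"
      proof (cases "i = k")
        case True
        then show ?thesis using * False boundary less.prems by auto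
      next
        case False
        then show ?thesis
          using * column[OF _ _ J, of i k] column[OF _ _ J, of k i] by auto
      qed
    qed
  qed
  have "\<forall>k\<le>d. f i j k \<in> S \<and> f k j i \<in> S" if "i \<le> d" for i
    using that
  proof (induction i rule: less_induct)
    case (less i)
    have *: "{k \<in> {..d}. f i j k \<notin> S} \<subseteq> {i + e..<i + e + j}"
            "{k \<in> {..d}. f k j i \<notin> S} \<subseteq> {i + e..<i + e + j}"
      using less e[of i]
      by (auto simp: not_le dest: not_le_imp_less)
        (meson nat_le_linear not_le order.strict_implies_order)+
    show ?case
    proof (intro allI impI conjI)
      fix k assume "k \<le> d"
      show "f i j k \<in> S"
        by (rule vandermonde_subspace_exceptions[OF S _ inj *(1), where m = j])
           (use right[of i j] less.prems \<open>j \<le> d\<close> \<open>k \<le> d\<close> in auto)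
      show "f k j i \<in> S"
        by (rule vandermonde_subspace_exceptions[OF S _ inj *(2), where m = j])
           (use left[of i j] less.prems \<open>j \<le> d\<close> \<open>k \<le> d\<close> in auto)
    qed
  qed
  then show ?case using less.prems by blast
qed

section \<open>Spectral resolutions and the algebras they generate\<close>

interpretation Endo: vector_space End_scale
  by (rule vector_space_End_scale)

lemma End_sum_apply: "(\<Sum>i\<in>I. End_scale (c i) (F i)) v = (\<Sum>i\<in>I. scale (c i) (F i v))"
  by (induction I rule: infinite_finite_induct) (auto simp: End_scale_def)

lemma End_D:
  assumes "F \<in> End"
  shows "F (x + y) = F x + F y" "F (x - y) = F x - F y" "F (scale c x) = scale c (F x)" "F 0 = 0"
    "F (\<Sum>i\<in>I. g i) = (\<Sum>i\<in>I. F (g i))"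
proof -
  interpret F: Vector_Spaces.linear scale scale F using assms by (simp add: End_def)
  show "F (x + y) = F x + F y" "F (x - y) = F x - F y" "F (scale c x) = scale c (F x)" "F 0 = 0"
    "F (\<Sum>i\<in>I. g i) = (\<Sum>i\<in>I. F (g i))"
    by (rule F.add F.diff F.scale F.zero F.sum)+
qed

lemma End_I:
  assumes "\<And>x y. F (x + y) = F x + F y" "\<And>c x. F (scale c x) = scale c (F x)"
  shows "F \<in> End"
  unfolding End_def using assms
  by (auto simp: Vector_Spaces.linear_def intro!: vector_space_axioms module_axioms
      module_hom.intro module_hom_axioms.intro)

lemma End_comp: "F \<in> End \<Longrightarrow> G \<in> End \<Longrightarrow> F \<circ> G \<in> End"
  by (intro End_I) (auto simp: End_D)

lemma generated_subalgebra_subset_End: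
  assumes "A \<in> End"
  shows "generated_subalgebra A \<subseteq> End"
  unfolding generated_subalgebra_def
proof (rule hull_minimal)
  show "subalgebra End"
    unfolding subalgebra_def
    by (auto simp: End_D End_scale_def scale_right_distrib mult.commute algebra_simps
        intro!: End_I End_comp)
qed (use assms in simp)

definition spectral_resolution :: "nat \<Rightarrow> ('b \<Rightarrow> 'b) \<Rightarrow> (nat \<Rightarrow> 'b \<Rightarrow> 'b) \<Rightarrow> (nat \<Rightarrow> 'a) \<Rightarrow> bool" where
  "spectral_resolution d A E \<theta> \<longleftrightarrow> A \<in> End \<and> inj_on \<theta> {..d} \<and> (\<forall>i\<le>d. E i \<in> End) \<and>
     (\<forall>v. (\<Sum>i\<le>d. E i v) = v) \<and> (\<forall>i\<le>d. \<forall>j\<le>d. \<forall>v. E i (E j v) = (if i = j then E j v else 0)) \<and>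
     (\<forall>i\<le>d. \<forall>v. A (E i v) = scale (\<theta> i) (E i v))"

lemma spectral_resolution_power:
  assumes "spectral_resolution d A E \<theta>"
  shows "(A ^^ t) v = (\<Sum>i\<le>d. scale (\<theta> i ^ t) (E i v))"
proof (induction t)
  case 0
  then show ?case using assms by (simp add: spectral_resolution_def)
next
  case (Suc t)
  have "A \<in> End" using assms by (simp add: spectral_resolution_def)
  then have "(A ^^ Suc t) v = (\<Sum>i\<le>d. scale (\<theta> i ^ t) (A (E i v)))"
    using Suc by (simp add: End_D)
  also have "\<dots> = (\<Sum>i\<le>d. scale (\<theta> i ^ Suc t) (E i v))"
    using assms by (intro sum.cong) (auto simp: spectral_resolution_def mult.commute)
  finally show ?case .
qed

text \<open>
  By the Vandermonde argument modulo a subalgebra containing \<open>A\<close>, the idempotents lie in it as soon as all the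
  powers \<open>A\<^sup>t = \<Sum>\<^sub>i \<theta>\<^sub>i\<^sup>t E\<^sub>i\<close> do.
\<close>

lemma spectral_idempotent_in_algebra:
  assumes sr: "spectral_resolution d A E \<theta>" and "i \<le> d"
  shows "E i \<in> generated_subalgebra A"
  unfolding generated_subalgebra_def hull_def
proof (safe)
  fix T assume T: "subalgebra T" "{A} \<subseteq> T"
  have pow: "A ^^ t \<in> T" for t
    using T by (induction t) (auto simp: subalgebra_def)
  have "0 = End_scale 0 id" by (auto simp: End_scale_def)
  then have "0 \<in> T" using T by (metis subalgebra_def)
  then have sub: "Endo.subspace T"
    using T by (auto simp: subalgebra_def Endo.subspace_def)
  show "E i \<in> T"
  proof (rule Endo.vandermonde_subspace[OF sub, of "{..d}" \<theta> E])
    fix t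
    have "(\<Sum>i\<le>d. End_scale (\<theta> i ^ t) (E i)) = A ^^ t"
      by (auto simp: End_sum_apply spectral_resolution_power[OF sr])
    then show "(\<Sum>i\<le>d. End_scale (\<theta> i ^ t) (E i)) \<in> T" using pow by simp
  qed (use assms in \<open>auto simp: spectral_resolution_def\<close>)
qed

text \<open>
  Since the \<open>E\<^sub>i\<close> are orthogonal idempotents with sum \<open>I\<close>, their linear combinations form a
  subalgebra, and it contains \<open>A\<close>.
\<close>

lemma in_span_spectral_idempotents:
  assumes sr: "spectral_resolution d A E \<theta>" and "X \<in> generated_subalgebra A"
  shows "X \<in> Endo.span (E ` {..d})"
proof -
  have E: "E i \<in> End" "E i (E j v) = (if i = j then E j v else 0)"
    if "i \<le> d" "j \<le> d" for i j v
    using sr that by (auto simp: spectral_resolution_def)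
  have total: "(\<Sum>i\<le>d. E i v) = v" for v
    using sr by (auto simp: spectral_resolution_def)
  define T where "T = {F. \<exists>c. F = (\<Sum>i\<le>d. End_scale (c i) (E i))}"
  have "subalgebra T"
    unfolding subalgebra_def
  proof (intro conjI ballI allI)
    show "T \<subseteq> End"
      by (auto simp: T_def End_sum_apply E End_D[OF E(1)] scale_right_distrib sum.distrib scale_sum_right
          mult.commute intro!: End_I)
    show "id \<in> T"
      unfolding T_def by (auto intro!: exI[of _ "\<lambda>_. 1"] simp: fun_eq_iff End_sum_apply total)
    fix F G assume "F \<in> T" "G \<in> T"
    then obtain a b where F: "F = (\<Sum>i\<le>d. End_scale (a i) (E i))" and G: "G = (\<Sum>i\<le>d. End_scale (b i) (E i))"
      by (auto simp: T_def)
    show "F + G \<in> T"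
      unfolding T_def F G
      by (auto intro!: exI[of _ "\<lambda>i. a i + b i"] simp: Endo.scale_left_distrib sum.distrib)
    have "(F \<circ> G) v = (\<Sum>i\<le>d. scale (a i * b i) (E i v))" for v
      unfolding F G o_def End_sum_apply
      by (intro sum.cong refl) (simp add: End_D[OF E(1)] E if_distrib cong: if_cong)
    then show "F \<circ> G \<in> T"
      unfolding T_def by (auto intro!: exI[of _ "\<lambda>i. a i * b i"] simp: fun_eq_iff End_sum_apply)
  next
    fix c F assume "F \<in> T"
    then obtain a where F: "F = (\<Sum>i\<le>d. End_scale (a i) (E i))" by (auto simp: T_def)
    show "End_scale c F \<in> T"
      unfolding T_def F by (auto intro!: exI[of _ "\<lambda>i. c * a i"] simp: Endo.scale_sum_right)
  qed
  moreover have "A \<in> T"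
    unfolding T_def using spectral_resolution_power[OF sr, of 1]
    by (auto intro!: exI[of _ \<theta>] simp: fun_eq_iff End_sum_apply)
  ultimately have "X \<in> T"
    using assms(2) hull_minimal[of "{A}" T subalgebra] by (auto simp: generated_subalgebra_def)
  then obtain c where "X = (\<Sum>i\<le>d. End_scale (c i) (E i))" by (auto simp: T_def)
  moreover have "\<dots> \<in> Endo.span (E ` {..d})"
    by (intro Endo.span_sum Endo.span_scale Endo.span_base) auto
  ultimately show ?thesis by simp
qed

section \<open>Tridiagonal systems\<close>

text \<open>
  The map \<open>B\<close> moves \<open>U\<^sub>k\<close> by at most one step along the ordering, so \<open>B\<^sup>t\<close> sends \<open>U\<^sub>k\<close> into the sum of the
  \<open>U\<^sub>j\<close> with \<open>\<bar>j - k\<bar> \<le> t\<close>, which \<open>E\<^sub>i\<close> annihilates when \<open>\<bar>i - k\<bar> > t\<close>.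
\<close>

lemma standard_ordering_spectral_resolution:
  assumes "A \<in> End" "B \<in> End" and diag: "diagonalizable A"
    and ord: "standard_ordering A B d U" and idem: "primitive_idempotents d U E"
  shows "\<exists>\<theta>. spectral_resolution d A E \<theta>"
    and "i \<le> d \<Longrightarrow> k \<le> d \<Longrightarrow> i + t < k \<or> k + t < i \<Longrightarrow> E i \<circ> (B ^^ t) \<circ> E k = 0"
proof -
  have bij: "bij_betw U {..d} (eigenspaces A)"
    using ord by (simp add: standard_ordering_def atLeast0AtMost)
  have "\<exists>\<theta>. U i = {v. A v = scale \<theta> v}" if "i \<le> d" for i
    using bij_betwE[OF bij] that by (auto simp: eigenspaces_def)
  then obtain \<theta> where \<theta>: "\<And>i. i \<le> d \<Longrightarrow> U i = {v. A v = scale (\<theta> i) v}"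
    by metis
  have inj: "inj_on \<theta> {..d}"
    using bij \<theta> by (auto simp: bij_betw_def inj_on_def)
  have E: "E i \<in> End" if "i \<le> d" for i
    using idem that by (auto simp: primitive_idempotents_def)
  have EU: "E i v = (if i = j then v else 0)" if "v \<in> U j" "i \<le> d" "j \<le> d" for i j v
    using idem that by (auto simp: primitive_idempotents_def)
  have span: "span (\<Union>j\<le>d. U j) = UNIV"
    using diag bij by (auto simp: diagonalizable_def bij_betw_def)
  have U: "subspace (U i)" if "i \<le> d" for i
    using \<open>A \<in> End\<close> that by (auto simp: \<theta> subspace_def End_D scale_right_distrib mult.commute)
  have sub: "span (\<Union>j\<in>J. U j) \<subseteq> {v. P v}" if "subspace {v. P v}" "\<And>j v. j \<in> J \<Longrightarrow> v \<in> U j \<Longrightarrow> P v" for J P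
    using that by (intro span_minimal) auto
  have EinU: "E i v \<in> U i" if "i \<le> d" for i v
  proof -
    have "subspace {v. E i v \<in> U i}"
      using U[OF that] E[OF that] by (auto simp: subspace_def End_D)
    then have "span (\<Union>j\<le>d. U j) \<subseteq> {v. E i v \<in> U i}"
      by (rule sub) (use EU U[OF that] that in \<open>auto simp: subspace_0\<close>)
    then show ?thesis using span by auto
  qed
  have "subspace {v. (\<Sum>i\<le>d. E i v) = v}"
    by (auto simp: subspace_def End_D[OF E] sum.distrib scale_sum_right[symmetric])
  from sub[OF this, of "{..d}"] have total: "(\<Sum>i\<le>d. E i v) = v" for v
    using EU span by auto
  have "spectral_resolution d A E \<theta>"
    unfolding spectral_resolution_def using assms inj E total EU[OF EinU] EinU \<theta> by auto
  then show "\<exists>\<theta>. spectral_resolution d A E \<theta>" by blast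
  show "E i \<circ> (B ^^ t) \<circ> E k = 0" if ik: "i \<le> d" "k \<le> d" "i + t < k \<or> k + t < i"
  proof -
    define W where "W t = span (\<Union>j\<in>{j. j \<le> d \<and> j \<le> k + t \<and> k \<le> j + t}. U j)" for t
    have in_W: "v \<in> W t" if "v \<in> U j" "j \<le> d" "j \<le> k + t" "k \<le> j + t" for v j t
      unfolding W_def using that by (intro span_base) auto
    have zero_W: "0 \<in> W t" for t by (simp add: W_def span_zero)
    have BW: "B v \<in> W (Suc t)" if "v \<in> W t" for v t
    proof -
      have "subspace {v. B v \<in> W (Suc t)}"
        using \<open>B \<in> End\<close> by (auto simp: subspace_def End_D W_def span_zero span_add span_scale)
      moreover have "B v \<in> W (Suc t)" if v: "v \<in> U j" and j: "j \<in> {j. j \<le> d \<and> j \<le> k + t \<and> k \<le> j + t}" for v j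
      proof -
        have "B ` U j \<subseteq> {x + y + z | x y z. x \<in> zero_extend d U (int j - 1) \<and>
                            y \<in> zero_extend d U (int j) \<and> z \<in> zero_extend d U (int j + 1)}"
          using ord j by (simp add: standard_ordering_def)
        then obtain x y z where *: "B v = x + y + z" "x \<in> zero_extend d U (int j - 1)"
            "y \<in> zero_extend d U (int j)" "z \<in> zero_extend d U (int j + 1)"
          using v by blast
        have "w \<in> W (Suc t)" if "w \<in> zero_extend d U l" "\<bar>l - int j\<bar> \<le> 1" for w l
          using that j zero_W by (auto simp: zero_extend_def split: if_splits intro!: in_W[of w "nat l"])
        from this[OF *(2)] this[OF *(3)] this[OF *(4)] show ?thesis
          unfolding *(1) by (auto simp: W_def intro!: span_add)
      qed
      ultimately show ?thesis using sub[of "\<lambda>v. B v \<in> W (Suc t)"] that[unfolded W_def] by blast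
    qed
    have pow: "(B ^^ t) v \<in> W t" if "v \<in> U k" for t v
      using in_W[OF that] BW \<open>k \<le> d\<close> by (induction t) auto
    have "subspace {v. E i v = 0}"
      using E[OF ik(1)] by (auto simp: subspace_def End_D)
    then have "W t \<subseteq> {v. E i v = 0}"
      unfolding W_def by (rule sub) (use EU ik in auto)
    then have "E i ((B ^^ t) (E k v)) = 0" for v
      using pow[OF EinU[OF ik(2)]] by blast
    then show ?thesis by (simp add: fun_eq_iff)
  qed
qed

text \<open>
  Used once for each of the three middle factors of \<open>E'\<^sub>0 X Y Z E'\<^sub>0\<close>, this reduces membership in \<open>S\<close>
  to products of idempotents.
\<close>

lemma sandwich_in_subspace:
  assumes S: "Endo.subspace S" and sr: "spectral_resolution d A E \<theta>" and P: "P \<in> End"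
    and X: "X \<in> generated_subalgebra A" and E: "\<And>i. i \<le> d \<Longrightarrow> P \<circ> E i \<circ> Q \<in> S"
  shows "P \<circ> X \<circ> Q \<in> S"
proof -
  have "P \<circ> (F + G) \<circ> Q = (P \<circ> F \<circ> Q) + (P \<circ> G \<circ> Q)" "P \<circ> End_scale c F \<circ> Q = End_scale c (P \<circ> F \<circ> Q)"
    "P \<circ> 0 \<circ> Q = 0" for F G c
    using P by (auto simp: fun_eq_iff End_scale_def End_D)
  then have "Endo.subspace {X. P \<circ> X \<circ> Q \<in> S}"
    using S by (auto simp: Endo.subspace_def)
  then have "Endo.span (E ` {..d}) \<subseteq> {X. P \<circ> X \<circ> Q \<in> S}"
    using E by (intro Endo.span_minimal) auto
  then show ?thesis using in_span_spectral_idempotents[OF sr X] by blast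
qed

lemma tridiagonal_system_triple_products:
  assumes "tridiagonal_system d A E A' E'"
  shows "End_span {E' 0 \<circ> X \<circ> Y \<circ> Z \<circ> E' 0 | X Y Z.
             X \<in> generated_subalgebra A \<and> Y \<in> generated_subalgebra A' \<and> Z \<in> generated_subalgebra A} =
         End_span {E' 0 \<circ> X \<circ> E' 0 \<circ> Z \<circ> E' 0 | X Z.
             X \<in> generated_subalgebra A \<and> Z \<in> generated_subalgebra A}" (is ?span_eq)
    and "F \<in> {E' 0 \<circ> X \<circ> E' 0 | X. X \<in> generated_subalgebra A} \<Longrightarrow>
         G \<in> {E' 0 \<circ> X \<circ> E' 0 | X. X \<in> generated_subalgebra A} \<Longrightarrow> F \<circ> G = G \<circ> F"
proof -
  from assms obtain U U' where *: "A \<in> End" "A' \<in> End" "diagonalizable A" "diagonalizable A'"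
      "standard_ordering A A' d U" "primitive_idempotents d U E"
      "standard_ordering A' A d U'" "primitive_idempotents d U' E'"
    by (auto simp: tridiagonal_system_def tridiagonal_pair_def standard_idempotents_def)
  obtain \<theta> \<theta>' where sr: "spectral_resolution d A E \<theta>" and sr': "spectral_resolution d A' E' \<theta>'"
    using standard_ordering_spectral_resolution(1)[OF *(1,2,3,5,6)]
      standard_ordering_spectral_resolution(1)[OF *(2,1,4,7,8)] by blast
  note tri = standard_ordering_spectral_resolution(2)[OF *(1,2,3,5,6)]
  note tri' = standard_ordering_spectral_resolution(2)[OF *(2,1,4,7,8)]
  have E: "E i \<in> End" and E': "E' i \<in> End" if "i \<le> d" for i
    using sr sr' that by (auto simp: spectral_resolution_def)
  have inj: "inj_on \<theta> {..d}" "inj_on \<theta>' {..d}"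
    using sr sr' by (auto simp: spectral_resolution_def)
  define f where "f i j k = E' 0 \<circ> E i \<circ> E' j \<circ> E k \<circ> E' 0" for i j k
  have lin: "(\<Sum>i\<in>I. End_scale (c i) (P \<circ> F i \<circ> Q)) = P \<circ> (\<Sum>i\<in>I. End_scale (c i) (F i)) \<circ> Q"
    if "P \<in> End" for P Q F and c :: "nat \<Rightarrow> 'a" and I
    using that by (auto simp: fun_eq_iff End_sum_apply End_D)
  have pow: "(\<Sum>i\<le>d. End_scale (\<theta> i ^ t) (E i)) = A ^^ t"
      "(\<Sum>i\<le>d. End_scale (\<theta>' i ^ t) (E' i)) = A' ^^ t" for t
    by (auto simp: fun_eq_iff End_sum_apply spectral_resolution_power[OF sr] spectral_resolution_power[OF sr'])
  \<comment> \<open>In the next three facts summing over one index rebuilds a power of \<open>A'\<close> or \<open>A\<close> between two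
    idempotents that are too far apart.\<close>
  have mid: "(\<Sum>j\<le>d. End_scale (\<theta>' j ^ t) (f i j k)) = 0"
    if "i \<le> d" "k \<le> d" "i + t < k \<or> k + t < i" for i k t
  proof -
    have "(\<Sum>j\<le>d. End_scale (\<theta>' j ^ t) (f i j k)) = E' 0 \<circ> (E i \<circ> (A' ^^ t) \<circ> E k) \<circ> E' 0"
      using lin[of "E' 0 \<circ> E i" "\<lambda>j. \<theta>' j ^ t" E' "E k \<circ> E' 0" "{..d}"] E E' that
      by (simp add: f_def pow o_assoc End_comp)
    then show ?thesis using tri[OF that] E'[of 0] by (simp add: fun_eq_iff End_D)
  qed
  have right: "(\<Sum>k\<le>d. End_scale (\<theta> k ^ s) (f i j k)) = 0"
    if "i \<le> d" "j \<le> d" "s < j" for i j s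
  proof -
    have "(\<Sum>k\<le>d. End_scale (\<theta> k ^ s) (f i j k)) = E' 0 \<circ> E i \<circ> (E' j \<circ> (A ^^ s) \<circ> E' 0)"
      using lin[of "E' 0 \<circ> E i \<circ> E' j" "\<lambda>k. \<theta> k ^ s" E "E' 0" "{..d}"] E E' that
      by (simp add: f_def pow o_assoc End_comp)
    then show ?thesis using tri'[of j 0 s] E'[of 0] E[of i] that by (simp add: fun_eq_iff End_D)
  qed
  have left: "(\<Sum>i\<le>d. End_scale (\<theta> i ^ s) (f i j k)) = 0"
    if "k \<le> d" "j \<le> d" "s < j" for k j s
  proof -
    have "(\<Sum>i\<le>d. End_scale (\<theta> i ^ s) (f i j k)) = (E' 0 \<circ> (A ^^ s) \<circ> E' j) \<circ> E k \<circ> E' 0"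
      using lin[of "E' 0" "\<lambda>i. \<theta> i ^ s" E "E' j \<circ> E k \<circ> E' 0" "{..d}"] E' that
      by (simp add: f_def pow o_assoc)
    then show ?thesis using tri'[of 0 j s] that by (simp add: fun_eq_iff)
  qed
  show ?span_eq
    unfolding End_span_def
  proof (rule Endo.span_eq[THEN iffD2], intro conjI)
    let ?R = "{E' 0 \<circ> X \<circ> E' 0 \<circ> Z \<circ> E' 0 | X Z. X \<in> generated_subalgebra A \<and> Z \<in> generated_subalgebra A}"
    have S: "Endo.subspace (Endo.span ?R)" by simp
    have "f i j k \<in> Endo.span ?R" if "i \<le> d" "j \<le> d" "k \<le> d" for i j k
    proof (rule Endo.triple_family_in_subspace[OF S inj _ _ _ _ that])
      show "(\<forall>i\<le>d. \<forall>k\<le>d. f i 0 k \<in> Endo.span ?R) \<or> (\<forall>i\<le>d. \<forall>j\<le>d. f i j i \<in> Endo.span ?R)"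
        using spectral_idempotent_in_algebra[OF sr]
        by (intro disjI1 allI impI Endo.span_base) (auto simp: f_def)
    qed (use mid right left in \<open>auto simp: Endo.span_zero\<close>)
    note f_span = this
    show "{E' 0 \<circ> X \<circ> Y \<circ> Z \<circ> E' 0 | X Y Z. X \<in> generated_subalgebra A \<and> Y \<in> generated_subalgebra A'
            \<and> Z \<in> generated_subalgebra A} \<subseteq> Endo.span ?R"
    proof clarify
      fix X Y Z
      assume X: "X \<in> generated_subalgebra A" and Y: "Y \<in> generated_subalgebra A'"
        and Z: "Z \<in> generated_subalgebra A"
      have XE: "E' 0 \<circ> X \<circ> (E' j \<circ> E k \<circ> E' 0) \<in> Endo.span ?R" if "j \<le> d" "k \<le> d" for j k
        by (rule sandwich_in_subspace[OF S sr _ X]) (use f_span E' that in \<open>auto simp: f_def o_assoc\<close>)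
      have X_End: "X \<in> End" and Y_End: "Y \<in> End"
        using X Y *(1,2) generated_subalgebra_subset_End by blast+
      have XYE: "(E' 0 \<circ> X) \<circ> Y \<circ> (E k \<circ> E' 0) \<in> Endo.span ?R" if "k \<le> d" for k
        by (rule sandwich_in_subspace[OF S sr' _ Y])
           (use XE E' X_End that in \<open>auto simp: o_assoc End_comp\<close>)
      show "E' 0 \<circ> X \<circ> Y \<circ> Z \<circ> E' 0 \<in> Endo.span ?R"
        by (rule sandwich_in_subspace[OF S sr _ Z])
           (use XYE E' X_End Y_End in \<open>auto simp: o_assoc End_comp\<close>)
    qed
    show "?R \<subseteq> Endo.span {E' 0 \<circ> X \<circ> Y \<circ> Z \<circ> E' 0 | X Y Z. X \<in> generated_subalgebra A \<and> Y \<in> generated_subalgebra A'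
            \<and> Z \<in> generated_subalgebra A}"
      using spectral_idempotent_in_algebra[OF sr', of 0] by (auto intro!: Endo.span_base)
  qed
  \<comment> \<open>The antisymmetrised family vanishes on the diagonal \<open>i = k\<close>.\<close>
  have S0: "Endo.subspace {0}" by (simp add: Endo.subspace_def)
  have comm: "f i 0 k = f k 0 i" if "i \<le> d" "k \<le> d" for i k
  proof -
    have "f i 0 k - f k 0 i \<in> {0}"
      by (rule Endo.triple_family_in_subspace[OF S0 inj, where f = "\<lambda>i j k. f i j k - f k j i"])
         (use mid right left that in \<open>auto simp: Endo.scale_right_diff_distrib sum_subtractf\<close>)
    then show ?thesis by simp
  qed
  have E'0: "E' 0 \<circ> E' 0 = E' 0" using sr' by (auto simp: spectral_resolution_def fun_eq_iff)
  have commute: "(E' 0 \<circ> X \<circ> E' 0) \<circ> G = G \<circ> (E' 0 \<circ> X \<circ> E' 0)"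
    if X: "X \<in> generated_subalgebra A" and G: "G \<in> End"
      and gens: "\<And>i. i \<le> d \<Longrightarrow> (E' 0 \<circ> E i \<circ> E' 0) \<circ> G = G \<circ> (E' 0 \<circ> E i \<circ> E' 0)" for X G
  proof -
    have "Endo.subspace {X. (E' 0 \<circ> X \<circ> E' 0) \<circ> G = G \<circ> (E' 0 \<circ> X \<circ> E' 0)}"
      using E'[of 0] G by (auto simp: Endo.subspace_def fun_eq_iff End_scale_def End_D)
    then have "Endo.span (E ` {..d}) \<subseteq> {X. (E' 0 \<circ> X \<circ> E' 0) \<circ> G = G \<circ> (E' 0 \<circ> X \<circ> E' 0)}"
      using gens by (intro Endo.span_minimal) auto
    then show ?thesis using in_span_spectral_idempotents[OF sr X] by blast
  qed
  have EE: "(E' 0 \<circ> E i \<circ> E' 0) \<circ> (E' 0 \<circ> E k \<circ> E' 0) = f i 0 k" for i k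
    unfolding f_def by (metis E'0 o_assoc)
  \<comment> \<open>Commutation extends from idempotents to \<open>D\<close> in one argument at a time.\<close>
  have EX: "(E' 0 \<circ> X \<circ> E' 0) \<circ> (E' 0 \<circ> E k \<circ> E' 0) = (E' 0 \<circ> E k \<circ> E' 0) \<circ> (E' 0 \<circ> X \<circ> E' 0)"
    if X: "X \<in> generated_subalgebra A" and k: "k \<le> d" for X k
  proof (rule commute[OF X])
    show "E' 0 \<circ> E k \<circ> E' 0 \<in> End" using E E' k by (intro End_comp) auto
    show "(E' 0 \<circ> E i \<circ> E' 0) \<circ> (E' 0 \<circ> E k \<circ> E' 0) = (E' 0 \<circ> E k \<circ> E' 0) \<circ> (E' 0 \<circ> E i \<circ> E' 0)"
      if "i \<le> d" for i
      unfolding EE using that k by (rule comm)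
  qed
  show "F \<circ> G = G \<circ> F" if F: "F \<in> {E' 0 \<circ> X \<circ> E' 0 | X. X \<in> generated_subalgebra A}"
    and G: "G \<in> {E' 0 \<circ> X \<circ> E' 0 | X. X \<in> generated_subalgebra A}"
  proof -
    obtain X Z where X: "X \<in> generated_subalgebra A" "F = E' 0 \<circ> X \<circ> E' 0"
      and Z: "Z \<in> generated_subalgebra A" "G = E' 0 \<circ> Z \<circ> E' 0"
      using F G by blast
    have "G \<in> End"
      unfolding Z(2) using Z(1) E' generated_subalgebra_subset_End[OF *(1)] by (intro End_comp) auto
    then show ?thesis
      unfolding X(2)
    proof (rule commute[OF X(1)])
      show "(E' 0 \<circ> E i \<circ> E' 0) \<circ> G = G \<circ> (E' 0 \<circ> E i \<circ> E' 0)" if "i \<le> d" for i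
        unfolding Z(2) by (rule EX[OF Z(1) that, symmetric])
    qed
  qed
qed

end

theorem theorem2p4:
  fixes scale :: "'k::field \<Rightarrow> 'v::ab_group_add \<Rightarrow> 'v"
    and Basis :: "'v set"
    and d :: nat
    and A A' :: "'v \<Rightarrow> 'v"
    and E E' :: "nat \<Rightarrow> 'v \<Rightarrow> 'v"
    and D D' :: "('v \<Rightarrow> 'v) set"
  assumes "finite_dimensional_vector_space scale Basis"
    and "vector_space.dim scale (UNIV :: 'v set) > 0"
    and "vector_space.tridiagonal_system scale d A E A' E'"
    and "D = vector_space.generated_subalgebra scale A"
    and "D' = vector_space.generated_subalgebra scale A'"
  shows "vector_space.End_span scale
           {E' 0 \<circ> X \<circ> Y \<circ> Z \<circ> E' 0 | X Y Z. X \<in> D \<and> Y \<in> D' \<and> Z \<in> D} =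
         vector_space.End_span scale
           {E' 0 \<circ> X \<circ> E' 0 \<circ> Z \<circ> E' 0 | X Z. X \<in> D \<and> Z \<in> D}
       \<and> (\<forall>F \<in> {E' 0 \<circ> X \<circ> E' 0 | X. X \<in> D}.
          \<forall>G \<in> {E' 0 \<circ> X \<circ> E' 0 | X. X \<in> D}. F \<circ> G = G \<circ> F)"
proof -
  interpret finite_dimensional_vector_space scale Basis by (rule assms(1))
  show ?thesis
    using tridiagonal_system_triple_products[OF assms(3)] unfolding assms(4,5) by blast
qed

end
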